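(* Let $K$ be a field of characteristic different from $2$, let $m\ge1$, and let $a_s\in K$ $(-m\le s\le m)$ with $a_0=0$ and $a_{-s}=-a_s$ for $1\le s\le m$. For $n>2m$ let $C_n=\sum_{s=-m}^ma_s\Pi_n^s$ and $P_n^{\mathrm{cyc}}=\operatorname{perm}C_n$. Then $P_n^{\mathrm{cyc}}=0$ for every odd $n>2m$, and the even-size stable subsequence $(P_{2k}^{\mathrm{cyc}})_{2k>2m}$ has a homogeneous constant-coefficient annihilator of degree at most $$2^{2m-1}.$$
   Context: $\Pi_n$ is the $n\times n$ cyclic shift matrix, with $(i,j)$ entry $1$ if $j\equiv i+1\pmod n$ and $0$ otherwise. $\operatorname{perm}$ denotes the permanent. "Stable" refers to the range $n>2m$. A homogeneous constant-coefficient annihilator of degree $d$ of a sequence $(u_k)_{k>m}$ is a monic polynomial $t^d+c_1t^{d-1}+\dots+c_d$ with $u_{k+d}+c_1u_{k+d-1}+\dots+c_du_k=0$ for all $k>m$ (here $u_k=P_{2k}^{\mathrm{cyc}}$). *)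

theory Defs
  imports
    "Jordan_Normal_Form.Determinant"
    "Jordan_Normal_Form.Gauss_Jordan_Elimination"
    "HOL-Combinatorics.Permutations"
    "HOL-Computational_Algebra.Polynomial"
begin

text \<open>Matrix indices run over \<open>0, \<dots>, n - 1\<close>; since the condition on the entries is a congruence
  modulo \<open>n\<close>, this gives the same matrix as indices running over \<open>1, \<dots>, n\<close>.\<close>

definition cyclic_shift :: "nat \<Rightarrow> 'a::field mat" where
  "cyclic_shift n = mat n n (\<lambda>(i, j). if j mod n = (i + 1) mod n then 1 else 0)"

text \<open>Integer powers of an invertible square matrix. For a singular matrix and a negative
  exponent the value is unspecified; the lemma \<open>mat_inverse_cyclic_shift\<close> below shows that
  this does not concern the cyclic shift.\<close>

definition mat_powi :: "'a::field mat \<Rightarrow> int \<Rightarrow> 'a mat" where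
  "mat_powi A s = (if s \<ge> 0 then A ^\<^sub>m nat s else the (mat_inverse A) ^\<^sub>m nat (- s))"

lemma mat_inverse_cyclic_shift:
  "mat_inverse (cyclic_shift n :: 'a::field mat) = Some (transpose_mat (cyclic_shift n))"
proof -
  let ?P = "cyclic_shift n :: 'a mat" and ?T = "transpose_mat (cyclic_shift n) :: 'a mat"
  have P: "?P \<in> carrier_mat n n" and T: "?T \<in> carrier_mat n n"
    by (auto simp: cyclic_shift_def)
  have inj: "i = j" if "i < n" "j < n" "Suc i mod n = Suc j mod n" for i j
    using that by (auto simp: mod_Suc split: if_splits)
  have PT: "?P * ?T = 1\<^sub>m n"
  proof (rule eq_matI)
    fix i j assume "i < dim_row (1\<^sub>m n)" "j < dim_col (1\<^sub>m n)"
    then have ij: "i < n" "j < n" by auto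
    then have "(?P * ?T) $$ (i, j) =
      (\<Sum>k = 0..<n. (if k = Suc i mod n then 1 else 0) * (if k = Suc j mod n then 1 else 0))"
      by (auto simp: cyclic_shift_def scalar_prod_def intro!: sum.cong)
    also have "\<dots> = (\<Sum>k = 0..<n. if k = Suc i mod n
        then (if Suc i mod n = Suc j mod n then 1 else 0) else 0)"
      by (intro sum.cong) auto
    also have "\<dots> = (if Suc i mod n = Suc j mod n then 1 else 0)"
      using ij by simp
    finally show "(?P * ?T) $$ (i, j) = 1\<^sub>m n $$ (i, j)"
      using ij inj[OF ij] by auto
  qed (auto simp: cyclic_shift_def)
  have TP: "?T * ?P = 1\<^sub>m n"
    by (rule mat_mult_left_right_inverse[OF P T PT])
  have "?P \<in> Units (ring_mat TYPE('a) n ())"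
    using P T PT TP by (auto simp: Units_def ring_mat_simps)
  then obtain B where B: "mat_inverse ?P = Some B"
    using mat_inverse(1)[OF P, where b = "()"] by (cases "mat_inverse ?P") auto
  from mat_inverse(2)[OF P B] have PB: "?P * B = 1\<^sub>m n" and Bc: "B \<in> carrier_mat n n" by auto
  have "B = (?T * ?P) * B" unfolding TP using Bc by simp
  also have "\<dots> = ?T * (?P * B)" using T P Bc by (rule assoc_mult_mat)
  also have "\<dots> = ?T" unfolding PB using T by simp
  finally have "B = ?T" .
  with B show ?thesis by simp
qed

text \<open>The entry of a sum of matrices is written out as the sum of the entries, since the type of
  matrices of varying size carries no \<open>\<Sum>\<close>.\<close>

definition banded_circulant :: "nat \<Rightarrow> (int \<Rightarrow> 'a::field) \<Rightarrow> nat \<Rightarrow> 'a mat" where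
  "banded_circulant m a n =
     mat n n (\<lambda>ij. \<Sum>s = - int m..int m. (a s \<cdot>\<^sub>m mat_powi (cyclic_shift n) s) $$ ij)"

definition permanent :: "'a::comm_semiring_1 mat \<Rightarrow> 'a" where
  "permanent A = (if dim_row A = dim_col A
     then \<Sum>p\<in>{p. p permutes {0..<dim_row A}}. \<Prod>i = 0..<dim_row A. A $$ (i, p i) else 0)"

text \<open>The polynomial \<open>q = t\<^sup>d + c\<^sub>1 t\<^bsup>d - 1\<^esup> + \<dots> + c\<^sub>d\<close> annihilates the sequence \<open>(u k)\<close>,
  \<open>k > m\<close>; here \<open>coeff q (d - i)\<close> is \<open>c\<^sub>i\<close>.\<close>

definition annihilator_beyond :: "nat \<Rightarrow> (nat \<Rightarrow> 'a::field) \<Rightarrow> 'a poly \<Rightarrow> bool" where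
  "annihilator_beyond m u q \<longleftrightarrow>
     lead_coeff q = 1 \<and> (\<forall>k>m. (\<Sum>i\<le>degree q. coeff q i * u (k + i)) = 0)"

end

theory Submission
  imports Defs "Jordan_Normal_Form.Char_Poly"
begin

text \<open>Processing the rows in order and recording which columns of a window of width \<open>2m\<close> are taken
  gives a transfer matrix \<open>T\<close> of size \<open>2\<^sup>2\<^sup>m\<close>, indexed by the subsets of the window, such that the
  permanent is the trace of \<open>T\<^sup>n\<close>. Reversing walks shows that the transpose of \<open>T\<close> is the transfer
  matrix for \<open>s \<mapsto> a\<^sub>-\<^sub>s\<close> up to a permutation of the states, hence similar to \<open>- T\<close> in the skew case.
  So the characteristic polynomial of \<open>T\<close> is even, say \<open>q(t\<^sup>2)\<close>, and by Cayley--Hamilton \<open>q\<close>, of degree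
  half the size of \<open>T\<close>, annihilates the traces of the even powers. For odd \<open>n\<close> the permanent of a
  skew-symmetric matrix equals its own negative.\<close>

section \<open>Walks on the sets of occupied columns\<close>

text \<open>Row \<open>j\<close> takes column \<open>j + g j\<close>. A state \<open>S\<close> before row \<open>k\<close> records the columns already taken,
  as offsets from \<open>k\<close>; every column below \<open>k\<close> must have been taken by then. In \<open>admissible\<close>, the
  second conjunct is this requirement for column \<open>j\<close>, which no later row can reach.\<close>

definition occupied :: "(nat \<Rightarrow> nat) \<Rightarrow> nat \<Rightarrow> nat set \<Rightarrow> nat set" where
  "occupied g k S = {x. x + k \<in> S \<or> (\<exists>j<k. j + g j = x + k)}"

definition admissible :: "(nat \<Rightarrow> nat) \<Rightarrow> nat \<Rightarrow> nat set \<Rightarrow> bool" where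
  "admissible g k S \<longleftrightarrow>
     (\<forall>j<k. g j \<notin> occupied g j S \<and> 0 \<in> insert (g j) (occupied g j S))"

lemma occupied_0 [simp]: "occupied g 0 S = S"
  by (simp add: occupied_def)

lemma occupied_Suc:
  "occupied g (Suc k) S = {x. Suc x \<in> insert (g k) (occupied g k S)}"
  by (auto simp: occupied_def less_Suc_eq)

lemma admissible_0 [simp]: "admissible g 0 S"
  by (simp add: admissible_def)

lemma admissible_Suc:
  "admissible g (Suc k) S \<longleftrightarrow> admissible g k S \<and>
     g k \<notin> occupied g k S \<and> 0 \<in> insert (g k) (occupied g k S)"
  unfolding admissible_def less_Suc_eq by blast

lemma occupied_cong:
  "(\<And>j. j < k \<Longrightarrow> g j = h j) \<Longrightarrow> occupied g k S = occupied h k S"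
  by (auto simp: occupied_def)

lemma admissible_cong:
  assumes "\<And>j. j < k \<Longrightarrow> g j = h j"
  shows "admissible g k S = admissible h k S"
proof -
  have "occupied g j S = occupied h j S" if "j < k" for j
    using assms that by (intro occupied_cong) auto
  then show ?thesis using assms by (simp add: admissible_def)
qed

text \<open>A walk of length \<open>n > d\<close> forgets its initial state, so a closed walk can only start at \<open>R\<close>.\<close>

lemma admissible_closed_iff_bij:
  assumes dn: "d < n" and g: "\<And>j. j < n \<Longrightarrow> g j \<le> d"
  defines "R \<equiv> {x. \<exists>j<n. j + g j = x + n}"
  shows "admissible g n R \<longleftrightarrow> bij_betw (\<lambda>j. (j + g j) mod n) {0..<n} {0..<n}"
    (is "_ \<longleftrightarrow> bij_betw ?F _ _")
proof
  assume adm: "admissible g n R"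
  \<comment> \<open>Column \<open>k\<close> is taken by row \<open>k\<close>, by an earlier row, or
    by a row that wraps around and is therefore recorded in \<open>R\<close>. Injectivity then
    follows by counting.\<close>
  have "k \<in> ?F ` {0..<n}" if k: "k < n" for k
  proof -
    have "0 \<in> insert (g k) (occupied g k R)"
      using adm k by (simp add: admissible_def)
    then consider "g k = 0" | "k \<in> R" | "\<exists>j<k. j + g j = k"
      unfolding occupied_def by auto
    then have "\<exists>j<n. j + g j = k \<or> j + g j = k + n"
    proof cases
      case 1
      then show ?thesis using k by (intro exI[of _ k]) simp
    next
      case 2
      then show ?thesis unfolding R_def by blast
    next
      case 3
      then show ?thesis using k less_trans by blast
    qed
    then obtain j where j: "j < n" "j + g j = k \<or> j + g j = k + n" by blast
    then have "?F j = k" using k by auto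
    with j(1) show ?thesis by force
  qed
  then have "{0..<n} \<subseteq> ?F ` {0..<n}" by auto
  moreover have "?F ` {0..<n} \<subseteq> {0..<n}" using dn by auto
  ultimately have "?F ` {0..<n} = {0..<n}" by blast
  then show "bij_betw ?F {0..<n} {0..<n}"
    by (simp add: bij_betw_def eq_card_imp_inj_on)
next
  assume bij: "bij_betw ?F {0..<n} {0..<n}"
  have inj: "i = j" if "i < n" "j < n" "?F i = ?F j" for i j
    using inj_onD[OF bij_betw_imp_inj_on[OF bij] that(3)] that by simp
  have "g k \<notin> occupied g k R" if k: "k < n" for k
  proof
    assume "g k \<in> occupied g k R"
    \<comment> \<open>Row \<open>k\<close> collides with an earlier row or with one that wraps
      around. Either way the columns agree modulo \<open>n\<close>, so injectivity makes the rows
      equal, which the equation excludes.\<close>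
    then consider j where "j < n" "j + g j = k + g k + n" | j where "j < k" "j + g j = k + g k"
      by (auto simp: occupied_def R_def add.commute)
    then show False
    proof cases
      case 1
      then have "?F j = ?F k" by simp
      with inj[OF 1(1) k] 1 dn show False by auto
    next
      case 2
      then have "?F j = ?F k" by simp
      with inj[of j k] 2 k show False by auto
    qed
  qed
  moreover have "0 \<in> insert (g k) (occupied g k R)" if k: "k < n" for k
  proof -
    have "k \<in> ?F ` {0..<n}" using bij k by (simp add: bij_betw_def)
    then obtain j where j: "j < n" "?F j = k" by auto
    \<comment> \<open>Since \<open>d < n\<close>, a row wraps around at most once.\<close>
    have "j + g j < 2 * n" using g[OF j(1)] j(1) dn by simp
    then have "j + g j = k \<or> j + g j = k + n"
      using j(2) by (cases "j + g j < n") (auto simp: le_mod_geq)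
    then show ?thesis
    proof
      assume F: "j + g j = k"
      then have "j = k \<or> j < k" by auto
      with F show ?thesis by (auto simp: occupied_def)
    next
      assume "j + g j = k + n"
      with j(1) show ?thesis by (auto simp: occupied_def R_def)
    qed
  qed
  ultimately show "admissible g n R" by (simp add: admissible_def)
qed

text \<open>All walks of length \<open>n\<close> with the same displacements end in the same state,
  so at most one initial state closes up. A trace over the states therefore counts each bijective
  choice exactly once.\<close>

lemma card_closed_walks:
  assumes dn: "d < n" and g: "\<And>j. j < n \<Longrightarrow> g j \<le> d"
  shows "card {S \<in> Pow {..<d}. admissible g n S \<and> occupied g n S = S} =
    of_bool (bij_betw (\<lambda>j. (j + g j) mod n) {0..<n} {0..<n})"
proof -
  define R where "R = {x. \<exists>j<n. j + g j = x + n}"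
  have R: "R \<in> Pow {..<d}"
  proof -
    have "x < d" if "j < n" "j + g j = x + n" for x j
      using g[OF that(1)] that by linarith
    then show ?thesis by (auto simp: R_def)
  qed
  \<comment> \<open>No \<open>S\<close> inside the window contains \<open>x + n\<close>, as
    \<open>d < n\<close>.\<close>
  have occ: "occupied g n S = R" if "S \<in> Pow {..<d}" for S
    using that dn by (auto simp: occupied_def R_def)
  have "{S \<in> Pow {..<d}. admissible g n S \<and> occupied g n S = S} =
    (if admissible g n R then {R} else {})"
    using R occ by (auto split: if_splits)
  then show ?thesis
    using admissible_closed_iff_bij[OF assms] by (simp add: R_def)
qed

section \<open>The transfer matrix and its powers\<close>

text \<open>At most one \<open>c\<close> contributes: it is 0 if 0 is free, and otherwise
  \<open>c - 1\<close> is the element of \<open>S'\<close> that does not come from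
  \<open>S\<close>.\<close>

definition transfer_weight :: "nat \<Rightarrow> (nat \<Rightarrow> 'a::comm_ring_1) \<Rightarrow> nat set \<Rightarrow> nat set \<Rightarrow> 'a" where
  "transfer_weight d b S S' = (\<Sum>c\<le>d. b c *
     of_bool (c \<notin> S \<and> 0 \<in> insert c S \<and> S' = {x. Suc x \<in> insert c S}))"

text \<open>Matrix indices are numbers, so \<open>e\<close> is meant to enumerate the states, the
  subsets of \<open>{..<d}\<close>.\<close>

definition transfer_mat :: "nat \<Rightarrow> (nat \<Rightarrow> 'a::comm_ring_1) \<Rightarrow> (nat \<Rightarrow> nat set) \<Rightarrow> 'a mat" where
  "transfer_mat d b e = mat (2 ^ d) (2 ^ d) (\<lambda>(i, j). transfer_weight d b (e i) (e j))"

lemma transfer_mat_carrier [simp]: "transfer_mat d b e \<in> carrier_mat (2 ^ d) (2 ^ d)"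
  by (simp add: transfer_mat_def)

lemma occupied_subset:
  assumes "S \<subseteq> {..<d}" "\<And>j. j < k \<Longrightarrow> g j \<le> d"
  shows "occupied g k S \<subseteq> {..<d}"
proof
  fix x assume "x \<in> occupied g k S"
  then consider "x + k \<in> S" | j where "j < k" "j + g j = x + k"
    by (auto simp: occupied_def)
  then have "x < d"
  proof cases
    case 1
    then show ?thesis using assms(1) by auto
  next
    case 2
    then show ?thesis using assms(2)[of j] by simp
  qed
  then show "x \<in> {..<d}" by simp
qed

text \<open>The initial state and the displacements determine all later states, so the walks behind
  a matrix power can be summed as functions \<open>g\<close>. One more factor appends the
  displacement of row \<open>k\<close>.\<close>

lemma transfer_mat_power:
  fixes b :: "nat \<Rightarrow> 'a::comm_ring_1"
  assumes e: "bij_betw e {0..<2 ^ d} (Pow {..<d})" and i: "i < 2 ^ d" and "j < 2 ^ d"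
  shows "(transfer_mat d b e ^\<^sub>m k) $$ (i, j) =
    (\<Sum>g\<in>{0..<k} \<rightarrow>\<^sub>E {..d}. (\<Prod>l=0..<k. b (g l)) *
       of_bool (admissible g k (e i) \<and> occupied g k (e i) = e j))"
  using \<open>j < 2 ^ d\<close>
proof (induction k arbitrary: j)
  case 0
  have "e i = e j \<longleftrightarrow> i = j"
    using e i 0 by (auto simp: bij_betw_def inj_on_def)
  then show ?case using i 0 by (simp add: transfer_mat_def)
next
  case (Suc k)
  let ?T = "transfer_mat d b e" and ?G = "{0..<k} \<rightarrow>\<^sub>E {..d}"
  let ?w = "\<lambda>g. \<Prod>l=0..<k. b (g l)"
  let ?step = "\<lambda>c S S'. c \<notin> S \<and> 0 \<in> insert c S \<and> S' = {x. Suc x \<in> insert c S}"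
  have "(?T ^\<^sub>m Suc k) $$ (i, j) = (\<Sum>h = 0..<2 ^ d. (?T ^\<^sub>m k) $$ (i, h) * ?T $$ (h, j))"
    using i Suc.prems pow_carrier_mat[OF transfer_mat_carrier[of d b e], of k]
      carrier_matD[OF transfer_mat_carrier[of d b e]]
    by (simp add: scalar_prod_def)
  also have "\<dots> = (\<Sum>h = 0..<2 ^ d. \<Sum>g\<in>?G. \<Sum>c\<le>d. ?w g * b c *
      of_bool (admissible g k (e i) \<and> occupied g k (e i) = e h \<and> ?step c (e h) (e j)))"
  proof (rule sum.cong[OF refl])
    fix h assume "h \<in> {0..<2 ^ d :: nat}"
    then have h: "h < 2 ^ d" by simp
    have T: "?T $$ (h, j) = (\<Sum>c\<le>d. b c * of_bool (?step c (e h) (e j)))"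
      using h Suc.prems by (simp add: transfer_mat_def transfer_weight_def)
    show "(?T ^\<^sub>m k) $$ (i, h) * ?T $$ (h, j) = (\<Sum>g\<in>?G. \<Sum>c\<le>d. ?w g * b c *
      of_bool (admissible g k (e i) \<and> occupied g k (e i) = e h \<and> ?step c (e h) (e j)))"
      unfolding Suc.IH[OF h] T sum_product
      by (intro sum.cong refl) (simp only: of_bool_conj mult_ac)
  qed
  also have "\<dots> = (\<Sum>g\<in>?G. \<Sum>c\<le>d. ?w g * b c * (\<Sum>h = 0..<2 ^ d.
      of_bool (admissible g k (e i) \<and> occupied g k (e i) = e h \<and> ?step c (e h) (e j))))"
    unfolding sum_distrib_left
    by (rule trans, rule sum.swap, rule sum.cong, rule refl, rule sum.swap)
  \<comment> \<open>The intermediate state can only be \<open>occupied g k (e i)\<close>, which lies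
    in the window and hence has exactly one index.\<close>
  also have "\<dots> = (\<Sum>g\<in>?G. \<Sum>c\<le>d. ?w g * b c *
      of_bool (admissible g k (e i) \<and> ?step c (occupied g k (e i)) (e j)))"
  proof (intro sum.cong refl arg_cong2[of _ _ _ _ "(*)"])
    fix g c assume g: "g \<in> ?G"
    let ?O = "occupied g k (e i)"
    have "e i \<subseteq> {..<d}" using e i by (auto simp: bij_betw_def)
    then have "?O \<in> Pow {..<d}" using g occupied_subset[of "e i" d k g] by (auto simp: PiE_iff)
    have "(\<Sum>h = 0..<2 ^ d.
        of_bool (admissible g k (e i) \<and> ?O = e h \<and> ?step c (e h) (e j)) :: 'a) =
      (\<Sum>S\<in>Pow {..<d}. of_bool (admissible g k (e i) \<and> ?O = S \<and> ?step c S (e j)))"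
      by (rule sum.reindex_bij_betw[OF e])
    also have "\<dots> = (\<Sum>S\<in>Pow {..<d}. if S = ?O
        then of_bool (admissible g k (e i) \<and> ?step c ?O (e j)) else 0)"
      by (intro sum.cong) auto
    also have "\<dots> = of_bool (admissible g k (e i) \<and> ?step c ?O (e j))"
      using \<open>?O \<in> Pow {..<d}\<close> by simp
    finally show "(\<Sum>h = 0..<2 ^ d.
        of_bool (admissible g k (e i) \<and> ?O = e h \<and> ?step c (e h) (e j)) :: 'a) =
      of_bool (admissible g k (e i) \<and> ?step c ?O (e j))" .
  qed
  also have "\<dots> = (\<Sum>(c, g)\<in>{..d} \<times> ?G. ?w g * b c *
      of_bool (admissible g k (e i) \<and> ?step c (occupied g k (e i)) (e j)))"
    by (subst sum.swap) (simp add: sum.cartesian_product)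
  also have "\<dots> = (\<Sum>(c, g)\<in>{..d} \<times> ?G. (\<Prod>l=0..<Suc k. b ((g(k := c)) l)) *
      of_bool (admissible (g(k := c)) (Suc k) (e i) \<and> occupied (g(k := c)) (Suc k) (e i) = e j))"
  proof (intro sum.cong refl, clarify)
    fix c g
    have "occupied (g(k := c)) k (e i) = occupied g k (e i)"
      "admissible (g(k := c)) k (e i) = admissible g k (e i)"
      by (auto intro!: occupied_cong admissible_cong)
    then show "?w g * b c *
      of_bool (admissible g k (e i) \<and> ?step c (occupied g k (e i)) (e j)) =
      (\<Prod>l=0..<Suc k. b ((g(k := c)) l)) *
      of_bool (admissible (g(k := c)) (Suc k) (e i) \<and> occupied (g(k := c)) (Suc k) (e i) = e j)"
      by (auto simp: occupied_Suc admissible_Suc)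
  qed
  also have "\<dots> = (\<Sum>g\<in>(\<lambda>(c, g). g(k := c)) ` ({..d} \<times> ?G). (\<Prod>l=0..<Suc k. b (g l)) *
      of_bool (admissible g (Suc k) (e i) \<and> occupied g (Suc k) (e i) = e j))"
    by (subst sum.reindex) (auto intro!: inj_combinator sum.cong)
  also have "(\<lambda>(c, g). g(k := c)) ` ({..d} \<times> ?G) = {0..<Suc k} \<rightarrow>\<^sub>E {..d}"
    unfolding atLeast0_lessThan_Suc PiE_insert_eq by simp
  finally show ?case .
qed

section \<open>The permanent of a circulant as a trace\<close>

text \<open>Multiplying out the rows gives pairs of a permutation \<open>p\<close> and a choice
  \<open>g\<close> of one summand per row. A pair contributes only if \<open>p\<close> sends each
  \<open>i\<close> to \<open>(i + g i) mod n\<close>, so \<open>g\<close> determines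
  \<open>p\<close>, which exists exactly if this map is bijective.\<close>

lemma permanent_circulant:
  fixes b :: "nat \<Rightarrow> 'a::comm_ring_1"
  shows "permanent (mat n n (\<lambda>(i, j). \<Sum>c\<le>d. b c * of_bool (j = (i + c) mod n))) =
    (\<Sum>g\<in>{0..<n} \<rightarrow>\<^sub>E {..d}. (\<Prod>l=0..<n. b (g l)) *
       of_bool (bij_betw (\<lambda>j. (j + g j) mod n) {0..<n} {0..<n}))"
proof -
  let ?Perm = "{p. p permutes {0..<n}}"
  let ?w = "\<lambda>g. \<Prod>l=0..<n. b (g l)"
  have fin: "finite ?Perm" by (simp add: finite_permutations)
  have "permanent (mat n n (\<lambda>(i, j). \<Sum>c\<le>d. b c * of_bool (j = (i + c) mod n))) =
    (\<Sum>p\<in>?Perm. \<Prod>i=0..<n. \<Sum>c\<le>d. b c * of_bool (p i = (i + c) mod n))"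
    unfolding permanent_def by (auto intro!: sum.cong prod.cong simp: permutes_in_image)
  also have "\<dots> = (\<Sum>p\<in>?Perm. \<Sum>g\<in>{0..<n} \<rightarrow>\<^sub>E {..d}.
      \<Prod>i=0..<n. b (g i) * of_bool (p i = (i + g i) mod n))"
    by (intro sum.cong refl prod_sum_PiE) auto
  also have "\<dots> = (\<Sum>g\<in>{0..<n} \<rightarrow>\<^sub>E {..d}. ?w g *
      (\<Sum>p\<in>?Perm. of_bool (\<forall>i<n. p i = (i + g i) mod n)))"
  proof (subst sum.swap, intro sum.cong refl, unfold sum_distrib_left, intro sum.cong refl)
    fix g p :: "nat \<Rightarrow> nat"
    have "(\<Prod>i=0..<n. of_bool (p i = (i + g i) mod n)) =
      (of_bool (\<forall>i<n. p i = (i + g i) mod n) :: 'a)"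
      by (cases "\<forall>i<n. p i = (i + g i) mod n") (auto intro!: prod_zero)
    then show "(\<Prod>i=0..<n. b (g i) * of_bool (p i = (i + g i) mod n)) =
      ?w g * of_bool (\<forall>i<n. p i = (i + g i) mod n)"
      by (simp add: prod.distrib)
  qed
  also have "\<dots> = (\<Sum>g\<in>{0..<n} \<rightarrow>\<^sub>E {..d}. ?w g *
       of_bool (bij_betw (\<lambda>j. (j + g j) mod n) {0..<n} {0..<n}))"
  proof (intro sum.cong refl arg_cong2[of _ _ _ _ "(*)"])
    fix g :: "nat \<Rightarrow> nat"
    let ?F = "\<lambda>j. (j + g j) mod n"
    \<comment> \<open>\<open>permutes\<close> demands the identity outside
      \<open>{0..<n}\<close>.\<close>
    define q where "q i = (if i < n then ?F i else i)" for i
    have iff: "p permutes {0..<n} \<and> (\<forall>i<n. p i = ?F i) \<longleftrightarrow>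
        p = q \<and> bij_betw ?F {0..<n} {0..<n}" for p
    proof
      assume p: "p permutes {0..<n} \<and> (\<forall>i<n. p i = ?F i)"
      then have "p = q" by (auto simp: q_def fun_eq_iff permutes_def)
      moreover have "bij_betw ?F {0..<n} {0..<n} = bij_betw p {0..<n} {0..<n}"
        using p by (intro bij_betw_cong) auto
      ultimately show "p = q \<and> bij_betw ?F {0..<n} {0..<n}"
        using p permutes_imp_bij by blast
    next
      assume p: "p = q \<and> bij_betw ?F {0..<n} {0..<n}"
      moreover have "bij_betw ?F {0..<n} {0..<n} = bij_betw q {0..<n} {0..<n}"
        by (intro bij_betw_cong) (auto simp: q_def)
      ultimately show "p permutes {0..<n} \<and> (\<forall>i<n. p i = ?F i)"
        using bij_imp_permutes[of q "{0..<n}"] by (auto simp: q_def)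
    qed
    have "(\<Sum>p\<in>?Perm. of_bool (\<forall>i<n. p i = ?F i) :: 'a) =
      of_nat (card {p \<in> ?Perm. \<forall>i<n. p i = ?F i})"
      using fin by (simp add: sum_of_bool_eq Int_def)
    also have "{p \<in> ?Perm. \<forall>i<n. p i = ?F i} =
      (if bij_betw ?F {0..<n} {0..<n} then {q} else {})"
      using iff by (auto split: if_splits)
    finally show "(\<Sum>p\<in>?Perm. of_bool (\<forall>i<n. p i = ?F i) :: 'a) =
      of_bool (bij_betw ?F {0..<n} {0..<n})"
      by simp
  qed
  finally show ?thesis .
qed

text \<open>Both sides give \<open>g\<close> the same product of coefficients, and the number of
  closed walks with displacements \<open>g\<close> is the indicator of bijectivity.\<close>

lemma permanent_circulant_eq_trace:
  fixes b :: "nat \<Rightarrow> 'a::comm_ring_1"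
  assumes dn: "d < n" and e: "bij_betw e {0..<2 ^ d} (Pow {..<d})"
  shows "permanent (mat n n (\<lambda>(i, j). \<Sum>c\<le>d. b c * of_bool (j = (i + c) mod n))) =
    (\<Sum>i = 0..<2 ^ d. (transfer_mat d b e ^\<^sub>m n) $$ (i, i))"
proof -
  let ?G = "{0..<n} \<rightarrow>\<^sub>E {..d}"
  let ?w = "\<lambda>g. \<Prod>l=0..<n. b (g l)"
  have "(\<Sum>i = 0..<2 ^ d. (transfer_mat d b e ^\<^sub>m n) $$ (i, i)) =
    (\<Sum>i = 0..<2 ^ d. \<Sum>g\<in>?G. ?w g *
       of_bool (admissible g n (e i) \<and> occupied g n (e i) = e i))"
    by (intro sum.cong refl transfer_mat_power[OF e]) auto
  also have "\<dots> = (\<Sum>g\<in>?G. ?w g *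
      (\<Sum>i = 0..<2 ^ d. of_bool (admissible g n (e i) \<and> occupied g n (e i) = e i)))"
    unfolding sum_distrib_left by (rule sum.swap)
  also have "\<dots> = (\<Sum>g\<in>?G. ?w g *
       of_bool (bij_betw (\<lambda>j. (j + g j) mod n) {0..<n} {0..<n}))"
  proof (intro sum.cong refl arg_cong2[of _ _ _ _ "(*)"])
    fix g assume "g \<in> ?G"
    then have g: "g j \<le> d" if "j < n" for j using that by (auto simp: PiE_iff)
    have "(\<Sum>i = 0..<2 ^ d. of_bool (admissible g n (e i) \<and> occupied g n (e i) = e i) :: 'a) =
      (\<Sum>S\<in>Pow {..<d}. of_bool (admissible g n S \<and> occupied g n S = S))"
      by (rule sum.reindex_bij_betw[OF e])
    also have "\<dots> = of_nat (card {S \<in> Pow {..<d}. admissible g n S \<and> occupied g n S = S})"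
      by (simp add: sum_of_bool_eq Int_def)
    finally show "(\<Sum>i = 0..<2 ^ d.
        of_bool (admissible g n (e i) \<and> occupied g n (e i) = e i) :: 'a) =
      of_bool (bij_betw (\<lambda>j. (j + g j) mod n) {0..<n} {0..<n})"
      using card_closed_walks[OF dn g] by simp
  qed
  finally show ?thesis by (simp only: permanent_circulant)
qed

section \<open>Cayley--Hamilton and the parity of characteristic polynomials\<close>

text \<open>Comparison of coefficients in \<open>(t - A) * adj (t - A) = char_poly A\<close>; the sum over the
  powers of \<open>A\<close> then telescopes.\<close>

lemma Cayley_Hamilton_shifted:
  fixes A :: "'a::comm_ring_1 mat"
  assumes A: "A \<in> carrier_mat n n" and u: "u < n" and v: "v < n"
  shows "(\<Sum>i\<le>n. coeff (char_poly A) i * (A ^\<^sub>m (r + i)) $$ (u, v)) = 0"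
proof -
  let ?p = "char_poly A"
  define C where "C = char_poly_matrix A"
  define B where "B = adj_mat C"
  have C: "C \<in> carrier_mat n n" using A by (simp add: C_def)
  have B: "B \<in> carrier_mat n n" using adj_mat(1)[OF C] by (simp add: B_def)
  have CB: "C * B = ?p \<cdot>\<^sub>m 1\<^sub>m n"
    using adj_mat(2)[OF C] by (simp add: B_def C_def char_poly_def)
  have Clw: "C $$ (l, w) = (if l = w then [:0, 1:] else 0) - [:A $$ (l, w):]"
    if "l < n" "w < n" for l w
    using A that by (auto simp: C_def char_poly_matrix_def)
  have entry: "(if l = v then ?p else 0) =
      pCons 0 (B $$ (l, v)) - (\<Sum>w = 0..<n. smult (A $$ (l, w)) (B $$ (w, v)))"
    if l: "l < n" for l
  proof -
    have "(if l = v then ?p else 0) = (C * B) $$ (l, v)"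
      unfolding CB using l v by simp
    also have "\<dots> = (\<Sum>w = 0..<n. C $$ (l, w) * B $$ (w, v))"
      using B C l v by (simp add: scalar_prod_def)
    also have "\<dots> = (\<Sum>w = 0..<n. (if w = l then pCons 0 (B $$ (w, v)) else 0) -
        smult (A $$ (l, w)) (B $$ (w, v)))"
      using l by (intro sum.cong) (auto simp: Clw algebra_simps)
    also have "\<dots> = pCons 0 (B $$ (l, v)) - (\<Sum>w = 0..<n. smult (A $$ (l, w)) (B $$ (w, v)))"
      using l by (simp add: sum_subtractf)
    finally show ?thesis .
  qed
  have coeff_entry: "(if l = v then coeff ?p i else 0) =
      coeff (pCons 0 (B $$ (l, v))) i - (\<Sum>w = 0..<n. A $$ (l, w) * coeff (B $$ (w, v)) i)"
    if "l < n" for l i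
    using arg_cong[OF entry[OF that], of "\<lambda>q. coeff q i"] by (simp add: coeff_sum split: if_splits)
  \<comment> \<open>\<open>y i\<close> is the part of the identity for coefficient \<open>i\<close>
    that cancels against the shifted part for \<open>Suc i\<close>.\<close>
  define y where "y i = (\<Sum>w = 0..<n. (A ^\<^sub>m (r + Suc i)) $$ (u, w) * coeff (B $$ (w, v)) i)" for i
  have pow: "(A ^\<^sub>m Suc k) $$ (u, w) = (\<Sum>l = 0..<n. (A ^\<^sub>m k) $$ (u, l) * A $$ (l, w))"
    if "w < n" for k w
    using A u that by (simp add: scalar_prod_def)
  have step: "coeff ?p i * (A ^\<^sub>m (r + i)) $$ (u, v) =
      (\<Sum>l = 0..<n. (A ^\<^sub>m (r + i)) $$ (u, l) * coeff (pCons 0 (B $$ (l, v))) i) - y i" for i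
  proof -
    have "coeff ?p i * (A ^\<^sub>m (r + i)) $$ (u, v) =
      (\<Sum>l = 0..<n. (A ^\<^sub>m (r + i)) $$ (u, l) * (if l = v then coeff ?p i else 0))"
      using v by (simp add: if_distrib mult.commute sum.delta cong: if_cong)
    also have "\<dots> = (\<Sum>l = 0..<n. (A ^\<^sub>m (r + i)) $$ (u, l) * coeff (pCons 0 (B $$ (l, v))) i) -
      (\<Sum>l = 0..<n. \<Sum>w = 0..<n. (A ^\<^sub>m (r + i)) $$ (u, l) * A $$ (l, w) * coeff (B $$ (w, v)) i)"
      unfolding sum_subtractf[symmetric]
      by (intro sum.cong refl) (simp add: coeff_entry right_diff_distrib sum_distrib_left mult.assoc)
    also have "(\<Sum>l = 0..<n. \<Sum>w = 0..<n.
        (A ^\<^sub>m (r + i)) $$ (u, l) * A $$ (l, w) * coeff (B $$ (w, v)) i) = y i"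
      unfolding y_def add_Suc_right
      by (subst sum.swap, intro sum.cong refl) (simp add: pow sum_distrib_right del: pow_mat.simps)
    finally show ?thesis .
  qed
  have tele: "(\<Sum>i\<le>k. coeff ?p i * (A ^\<^sub>m (r + i)) $$ (u, v)) = - y k" for k
  proof (induction k)
    case 0
    show ?case using step[of 0] by simp
  next
    case (Suc k)
    show ?case using step[of "Suc k"] Suc by (simp add: y_def)
  qed
  \<comment> \<open>Beyond the degree of every adjugate entry in column \<open>v\<close>, so that
    \<open>y K\<close> vanishes, and at least \<open>n\<close>, so that no coefficient is
    lost.\<close>
  define K where "K = n + Suc (\<Sum>w = 0..<n. degree (B $$ (w, v)))"
  have "coeff (B $$ (w, v)) K = 0" if "w < n" for w
  proof (rule coeff_eq_0)
    have "degree (B $$ (w, v)) \<le> (\<Sum>w = 0..<n. degree (B $$ (w, v)))"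
      using that by (intro member_le_sum) auto
    then show "degree (B $$ (w, v)) < K" by (simp add: K_def)
  qed
  then have "y K = 0" by (simp add: y_def)
  then have "(\<Sum>i\<le>K. coeff ?p i * (A ^\<^sub>m (r + i)) $$ (u, v)) = 0" by (simp add: tele)
  also have "(\<Sum>i\<le>K. coeff ?p i * (A ^\<^sub>m (r + i)) $$ (u, v)) =
      (\<Sum>i\<le>n. coeff ?p i * (A ^\<^sub>m (r + i)) $$ (u, v))"
    using degree_monic_char_poly[OF A]
    by (intro sum.mono_neutral_right) (auto simp: K_def coeff_eq_0)
  finally show ?thesis .
qed

text \<open>The permutation matrix of an involution is its own inverse, so relabelling rows and
  columns by \<open>p\<close> is conjugation by it.\<close>

lemma char_poly_involution:
  fixes A B :: "'a::comm_ring_1 mat"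
  assumes A: "A \<in> carrier_mat n n" and B: "B \<in> carrier_mat n n"
    and p: "\<And>i. i < n \<Longrightarrow> p i < n" "\<And>i. i < n \<Longrightarrow> p (p i) = i"
    and AB: "\<And>i j. i < n \<Longrightarrow> j < n \<Longrightarrow> A $$ (i, j) = B $$ (p i, p j)"
  shows "char_poly A = char_poly B"
proof -
  define P :: "'a mat" where "P = mat n n (\<lambda>(i, j). if j = p i then 1 else 0)"
  have P: "P \<in> carrier_mat n n" by (simp add: P_def)
  have left: "(P * X) $$ (i, j) = X $$ (p i, j)"
    if "X \<in> carrier_mat n n" "i < n" "j < n" for X i j
  proof -
    have "(P * X) $$ (i, j) = (\<Sum>k = 0..<n. if k = p i then X $$ (p i, j) else 0)"
      using that p(1)[of i]
      by (simp add: P_def scalar_prod_def if_distrib[of "\<lambda>x. x * _"] cong: if_cong)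
    then show ?thesis using p that by simp
  qed
  have right: "(X * P) $$ (i, j) = X $$ (i, p j)"
    if "X \<in> carrier_mat n n" "i < n" "j < n" for X i j
  proof -
    have "j = p k \<longleftrightarrow> k = p j" if "k < n" for k
      using p that \<open>j < n\<close> by metis
    then have "(X * P) $$ (i, j) = (\<Sum>k = 0..<n. if k = p j then X $$ (i, p j) else 0)"
      using that p(1)[of j]
      by (simp add: P_def scalar_prod_def if_distrib[of "\<lambda>x. _ * x"] cong: if_cong)
    then show ?thesis using p that by simp
  qed
  have PP: "P * P = 1\<^sub>m n"
  proof (rule eq_matI)
    fix i j assume "i < dim_row (1\<^sub>m n :: 'a mat)" "j < dim_col (1\<^sub>m n :: 'a mat)"
    then show "(P * P) $$ (i, j) = 1\<^sub>m n $$ (i, j)"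
      using p by (subst left) (auto simp: P_def)
  qed (auto simp: P_def)
  have "A = P * B * P"
  proof (rule eq_matI)
    fix i j assume "i < dim_row (P * B * P)" "j < dim_col (P * B * P)"
    then have "i < n" "j < n" by (auto simp: P_def)
    moreover have "P * B \<in> carrier_mat n n" using P B by simp
    ultimately show "A $$ (i, j) = (P * B * P) $$ (i, j)"
      using p AB B by (simp add: left right)
  qed (use A P in auto)
  then have "similar_mat A B"
    unfolding similar_mat_def using similar_mat_witI[OF PP PP _ A B P P] by blast
  then show ?thesis by (rule char_poly_similar)
qed

text \<open>Substituting -t for t in t + A gives -(t - A), and this substitution, being a ring
  homomorphism, passes through the determinant.\<close>

lemma coeff_char_poly_uminus:
  fixes A :: "'a::comm_ring_1 mat"
  assumes A: "A \<in> carrier_mat n n"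
  shows "(- 1) ^ i * coeff (char_poly (- A)) i = (- 1) ^ n * coeff (char_poly A) i"
proof -
  have hom: "comm_ring_hom (\<lambda>p :: 'a poly. pcompose p [:0, - 1:])"
    by unfold_locales (auto simp: pcompose_add pcompose_mult pcompose_1)
  have "map_mat (\<lambda>p. pcompose p [:0, - 1:]) (char_poly_matrix (- A)) = (- 1) \<cdot>\<^sub>m char_poly_matrix A"
    using A by (intro eq_matI) (auto simp: char_poly_matrix_def pcompose_pCons pcompose_add)
  then have "det (map_mat (\<lambda>p. pcompose p [:0, - 1:]) (char_poly_matrix (- A))) =
      (- 1) ^ n * char_poly A"
    using A carrier_matD[OF char_poly_matrix_closed[OF A]] by (simp add: char_poly_def)
  then have "pcompose (char_poly (- A)) [:0, - 1:] = (- 1) ^ n * char_poly A"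
    unfolding char_poly_def[of "- A"] comm_ring_hom.hom_det[OF hom] .
  from arg_cong[OF this, of "\<lambda>p. coeff p i"] show ?thesis
    by (cases "even n") (simp_all add: coeff_pcompose_linear)
qed

lemma two_neq_0_if_CHAR_neq_2:
  assumes "CHAR('a::field) \<noteq> 2"
  shows "(2 :: 'a) \<noteq> 0"
proof
  assume "(2 :: 'a) = 0"
  then have "CHAR('a) dvd 2" using of_nat_eq_0_iff_char_dvd[where 'a = 'a, of 2] by simp
  with assms show False
    using CHAR_not_1'[where 'a = 'a] prime_nat_iff two_is_prime_nat by (metis One_nat_def)
qed

lemma coeff_char_poly_odd:
  fixes A :: "'a::field mat"
  assumes "CHAR('a) \<noteq> 2" and A: "A \<in> carrier_mat n n" and "even n" "odd i"
    and eq: "char_poly (- A) = char_poly A"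
  shows "coeff (char_poly A) i = 0"
proof -
  note two_neq_0_if_CHAR_neq_2[OF assms(1)]
  moreover have "2 * coeff (char_poly A) i = 0"
    using coeff_char_poly_uminus[OF A, of i] \<open>even n\<close> \<open>odd i\<close> by (simp add: eq)
  ultimately show ?thesis by simp
qed

section \<open>Reversal of walks\<close>

text \<open>Reading a walk backwards replaces each state by its reflected complement and each displacement
  \<open>c\<close> by \<open>d - c\<close>.\<close>

definition reflect_compl :: "nat \<Rightarrow> nat set \<Rightarrow> nat set" where
  "reflect_compl d S = {x. x < d \<and> d - 1 - x \<notin> S}"

lemma reflect_compl_reflect_compl: "S \<subseteq> {..<d} \<Longrightarrow> reflect_compl d (reflect_compl d S) = S"
  by (auto simp: reflect_compl_def)

text \<open>Put \<open>U = insert c S\<close>, a subset of \<open>{..d}\<close> containing 0.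
  Reflecting the complement of \<open>U\<close> in \<open>{..d}\<close> by
  \<open>x \<mapsto> d - x\<close> gives the reflected complement of \<open>S'\<close>. Adding
  \<open>d - c\<close>, the image of \<open>c\<close>, and shifting down gives that of
  \<open>S\<close>, which is \<open>U\<close> without \<open>c\<close>.\<close>

lemma reflect_compl_step:
  assumes S: "S \<subseteq> {..<d}" and c: "c \<le> d" "c \<notin> S" "0 \<in> insert c S"
    and S': "S' = {x. Suc x \<in> insert c S}"
  shows "d - c \<notin> reflect_compl d S'" "0 \<in> insert (d - c) (reflect_compl d S')"
    "reflect_compl d S = {x. Suc x \<in> insert (d - c) (reflect_compl d S')}"
proof -
  have R: "x \<in> reflect_compl d S' \<longleftrightarrow> x < d \<and> d - x \<notin> insert c S" for x
    by (auto simp: reflect_compl_def S' Suc_diff_Suc)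
  have R0: "x \<in> reflect_compl d S \<longleftrightarrow> x < d \<and> d - Suc x \<notin> S" for x
    by (simp add: reflect_compl_def)
  show "d - c \<notin> reflect_compl d S'" using c by (auto simp: R)
  show "0 \<in> insert (d - c) (reflect_compl d S')"
    using c S by (cases "c = d") (auto simp: R)
  show "reflect_compl d S = {x. Suc x \<in> insert (d - c) (reflect_compl d S')}"
  proof (rule Set.set_eqI)
    fix x
    show "x \<in> reflect_compl d S \<longleftrightarrow>
      x \<in> {x. Suc x \<in> insert (d - c) (reflect_compl d S')}"
    proof (cases "x = d - 1")
      \<comment> \<open>Here \<open>Suc x\<close> is outside the window; for \<open>d > 0\<close>
        both memberships amount to \<open>c = 0\<close>.\<close>
      case True
      then show ?thesis using c by (cases "c = 0") (auto simp: R R0)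
    next
      case False
      moreover have "Suc x = d - c \<longleftrightarrow> x < d \<and> d - Suc x = c" using c by auto
      ultimately show ?thesis using c by (auto simp: R R0)
    qed
  qed
qed

section \<open>Entries of the banded circulant\<close>

lemma cyclic_shift_power:
  fixes n :: nat
  assumes "i < n" "j < n"
  shows "(cyclic_shift n ^\<^sub>m k :: 'a::field mat) $$ (i, j) = of_bool (j = (i + k) mod n)"
  using assms(2)
proof (induction k arbitrary: j)
  case (Suc k)
  have "(cyclic_shift n ^\<^sub>m Suc k :: 'a mat) $$ (i, j) =
    (\<Sum>l = 0..<n. of_bool (l = (i + k) mod n) * (if j = (l + 1) mod n then 1 else 0))"
    using assms(1) Suc by (simp add: scalar_prod_def cyclic_shift_def)
  also have "\<dots> = (\<Sum>l = 0..<n. if l = (i + k) mod n then of_bool (j = (i + Suc k) mod n) else 0)"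
    by (intro sum.cong) (auto simp: mod_Suc_eq)
  also have "\<dots> = of_bool (j = (i + Suc k) mod n)"
    using assms(1) by simp
  finally show ?case .
qed (use assms in \<open>auto simp: cyclic_shift_def\<close>)

lemma transpose_cyclic_shift_power:
  assumes "i < n" "j < n"
  shows "(transpose_mat (cyclic_shift n) ^\<^sub>m k :: 'a::field mat) $$ (i, j) =
    of_bool (i = (j + k) mod n)"
  using assms(2)
proof (induction k arbitrary: j)
  case (Suc k)
  have "(transpose_mat (cyclic_shift n) ^\<^sub>m Suc k :: 'a mat) $$ (i, j) =
    (\<Sum>l = 0..<n. of_bool (i = (l + k) mod n) * (if l = (j + 1) mod n then 1 else 0))"
    using assms(1) Suc by (simp add: scalar_prod_def cyclic_shift_def)
  also have "\<dots> = (\<Sum>l = 0..<n. if l = (j + 1) mod n then of_bool (i = (j + Suc k) mod n) else 0)"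
    by (intro sum.cong) (auto simp: mod_add_left_eq)
  also have "\<dots> = of_bool (i = (j + Suc k) mod n)"
    using assms(1) by simp
  finally show ?case .
qed (use assms in \<open>auto simp: cyclic_shift_def\<close>)

text \<open>Divisibility in the integers treats both signs of \<open>s\<close> alike; negative
  powers are powers of the transpose.\<close>

lemma mat_powi_cyclic_shift:
  assumes "i < n" "j < n"
  shows "(mat_powi (cyclic_shift n) s :: 'a::field mat) $$ (i, j) =
    of_bool (int n dvd int j - (int i + s))"
proof (cases "s \<ge> 0")
  case True
  then obtain k where "s = int k" using nonneg_int_cases by blast
  moreover have "j = (i + k) mod n \<longleftrightarrow> int n dvd int j - (int i + int k)"
    using assms by (metis mod_eq_dvd_iff mod_less of_nat_add of_nat_eq_iff zmod_int)
  ultimately show ?thesis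
    using assms by (simp add: mat_powi_def cyclic_shift_power)
next
  case False
  then obtain k where s: "s = - int k" using nonpos_int_cases[of s] by auto
  have "i = (j + k) mod n \<longleftrightarrow> int n dvd int i - (int j + int k)"
    using assms by (metis mod_eq_dvd_iff mod_less of_nat_add of_nat_eq_iff zmod_int)
  also have "int i - (int j + int k) = - (int j - (int i + s))" by (simp add: s)
  also have "int n dvd - (int j - (int i + s)) \<longleftrightarrow> int n dvd int j - (int i + s)"
    by (rule dvd_minus_iff)
  finally have iff: "i = (j + k) mod n \<longleftrightarrow> int n dvd int j - (int i + s)" .
  have "(mat_powi (cyclic_shift n) s :: 'a mat) = transpose_mat (cyclic_shift n) ^\<^sub>m k"
    using False s by (simp add: mat_powi_def mat_inverse_cyclic_shift)
  then show ?thesis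
    by (simp only: transpose_cyclic_shift_power[OF assms] iff)
qed

lemma mat_powi_cyclic_shift_dim [simp]:
  "dim_row (mat_powi (cyclic_shift n) s :: 'a::field mat) = n"
  "dim_col (mat_powi (cyclic_shift n) s :: 'a::field mat) = n"
proof -
  have "(cyclic_shift n :: 'a mat) \<in> carrier_mat n n" by (simp add: cyclic_shift_def)
  then have "(mat_powi (cyclic_shift n) s :: 'a mat) \<in> carrier_mat n n"
    by (simp add: mat_powi_def mat_inverse_cyclic_shift pow_carrier_mat)
  then show "dim_row (mat_powi (cyclic_shift n) s :: 'a mat) = n"
    "dim_col (mat_powi (cyclic_shift n) s :: 'a mat) = n"
    by auto
qed

lemma banded_circulant_carrier [simp]: "banded_circulant m a n \<in> carrier_mat n n"
  by (simp add: banded_circulant_def)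

lemma banded_circulant_entry:
  assumes "i < n" "j < n"
  shows "banded_circulant m a n $$ (i, j) =
    (\<Sum>s = - int m..int m. a s * of_bool (int n dvd int j - (int i + s)))"
  using assms by (simp add: banded_circulant_def mat_powi_cyclic_shift)

lemma banded_circulant_skew:
  assumes "\<And>s. \<bar>s\<bar> \<le> int m \<Longrightarrow> a (- s) = - a s" and "i < n" "j < n"
  shows "banded_circulant m a n $$ (j, i) = - banded_circulant m a n $$ (i, j)"
proof -
  have "banded_circulant m a n $$ (j, i) =
    (\<Sum>s = - int m..int m. a s * of_bool (int n dvd int i - (int j + s)))"
    using assms by (simp add: banded_circulant_entry)
  also have "\<dots> = (\<Sum>s = - int m..int m. a (- s) * of_bool (int n dvd int j - (int i + s)))"
  proof (rule sum.reindex_bij_witness[of _ uminus uminus])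
    fix s :: int
    have "int j - (int i + - s) = - (int i - (int j + s))" by simp
    then show "a (- (- s)) * of_bool (int n dvd int j - (int i + - s)) =
        a s * of_bool (int n dvd int i - (int j + s))"
      by (simp only: dvd_minus_iff minus_minus)
  qed auto
  also have "\<dots> = - (\<Sum>s = - int m..int m. a s * of_bool (int n dvd int j - (int i + s)))"
    unfolding sum_negf[symmetric] using assms(1) by (intro sum.cong) auto
  finally show ?thesis using assms by (simp add: banded_circulant_entry)
qed

section \<open>Permanents of skew matrices and of shifted columns\<close>

text \<open>Inverting the permutations shows that the permanent is invariant under transposition,
  while skewness changes the sign of all \<open>n\<close> factors.\<close>

lemma permanent_skew:
  fixes A :: "'a::comm_ring_1 mat"
  assumes A: "A \<in> carrier_mat n n"
    and skew: "\<And>i j. i < n \<Longrightarrow> j < n \<Longrightarrow> A $$ (j, i) = - A $$ (i, j)"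
  shows "permanent A = (- 1) ^ n * permanent A"
proof -
  let ?Perm = "{p. p permutes {0..<n}}"
  have P: "permanent A = (\<Sum>p\<in>?Perm. \<Prod>i = 0..<n. A $$ (i, p i))"
    using A by (simp add: permanent_def)
  also have "\<dots> = (\<Sum>p\<in>?Perm. \<Prod>i = 0..<n. A $$ (i, Hilbert_Choice.inv p i))"
    by (rule sum_permutations_inverse)
  also have "\<dots> = (\<Sum>p\<in>?Perm. (- 1) ^ n * (\<Prod>i = 0..<n. A $$ (i, p i)))"
  proof (rule sum.cong[OF refl])
    fix p assume "p \<in> ?Perm"
    then have p: "p permutes {0..<n}" by simp
    have "(\<Prod>i = 0..<n. A $$ (i, Hilbert_Choice.inv p i)) =
        (\<Prod>i = 0..<n. A $$ (p i, Hilbert_Choice.inv p (p i)))"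
      by (rule prod.reindex_bij_betw[OF permutes_imp_bij[OF p], symmetric])
    also have "\<dots> = (\<Prod>i = 0..<n. - A $$ (i, p i))"
      using p by (intro prod.cong) (auto simp: permutes_inverses permutes_in_image intro!: skew)
    also have "\<dots> = (- 1) ^ n * (\<Prod>i = 0..<n. A $$ (i, p i))"
      by (simp add: prod_uminus)
    finally show "(\<Prod>i = 0..<n. A $$ (i, Hilbert_Choice.inv p i)) =
      (- 1) ^ n * (\<Prod>i = 0..<n. A $$ (i, p i))" .
  qed
  finally show ?thesis unfolding P by (simp add: sum_distrib_left)
qed

text \<open>Shifting the columns by \<open>m\<close> makes all displacements nonnegative.\<close>

lemma permanent_banded_circulant:
  "permanent (banded_circulant m a n) = permanent
     (mat n n (\<lambda>(i, j). \<Sum>c\<le>2 * m. a (int c - int m) * of_bool (j = (i + c) mod n)))"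
    (is "_ = permanent ?A")
proof -
  let ?B = "banded_circulant m a n" and ?Perm = "{p. p permutes {0..<n}}"
  define sh where "sh j = (if j < n then (j + m) mod n else j)" for j
  \<comment> \<open>The assumption \<open>i \<le> j\<close> keeps the subtraction of naturals exact;
    the other order follows by symmetry.\<close>
  have inj: "i = j" if "(i + m) mod n = (j + m) mod n" "i < n" "j < n" "i \<le> j" for i j
  proof -
    have "n dvd (j + m) - (i + m)"
      using that(1,4) mod_eq_dvd_iff_nat[of "i + m" "j + m" n] by simp
    then have "n dvd j - i" by simp
    moreover have "j - i < n" using that by simp
    ultimately have "j - i = 0" using nat_dvd_not_less by blast
    with that show ?thesis by simp
  qed
  have "inj_on sh {0..<n}"
  proof (rule inj_onI)
    fix i j assume "i \<in> {0..<n}" "j \<in> {0..<n}" "sh i = sh j"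
    then show "i = j" using inj[of i j] inj[of j i] by (cases "i \<le> j") (auto simp: sh_def)
  qed
  moreover have "sh ` {0..<n} \<subseteq> {0..<n}" by (auto simp: sh_def)
  ultimately have "bij_betw sh {0..<n} {0..<n}"
    by (simp add: bij_betw_def endo_inj_surj)
  then have sh: "sh permutes {0..<n}" by (rule bij_imp_permutes) (simp add: sh_def)
  have entry: "?B $$ (i, j) = ?A $$ (i, sh j)" if "i < n" "j < n" for i j
  proof -
    have "?B $$ (i, j) = (\<Sum>s = - int m..int m. a s * of_bool (int n dvd int j - (int i + s)))"
      using that by (rule banded_circulant_entry)
    also have "\<dots> = (\<Sum>c\<le>2 * m. a (int c - int m) * of_bool ((j + m) mod n = (i + c) mod n))"
    proof (rule sum.reindex_bij_witness[of _ "\<lambda>c. int c - int m" "\<lambda>s. nat (s + int m)"])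
      fix s assume s: "s \<in> {- int m..int m}"
      have "(j + m) mod n = (i + nat (s + int m)) mod n \<longleftrightarrow>
          int n dvd int (j + m) - int (i + nat (s + int m))"
        by (metis mod_eq_dvd_iff of_nat_eq_iff zmod_int)
      also have "int (j + m) - int (i + nat (s + int m)) = int j - (int i + s)"
        using s by simp
      finally show "a (int (nat (s + int m)) - int m) *
          of_bool ((j + m) mod n = (i + nat (s + int m)) mod n) =
          a s * of_bool (int n dvd int j - (int i + s))"
        using s by simp
    qed auto
    finally show ?thesis using that by (simp add: sh_def)
  qed
  have "permanent ?B = (\<Sum>p\<in>?Perm. \<Prod>i = 0..<n. ?A $$ (i, sh (p i)))"
    unfolding permanent_def
    using carrier_matD[OF banded_circulant_carrier[of m a n]]
    by (auto simp: permutes_in_image entry simp del: index_mat intro!: sum.cong prod.cong)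
  \<comment> \<open>Composition with \<open>sh\<close> is a bijection of the permutations, so
    permuting the columns preserves the permanent.\<close>
  also have "\<dots> = (\<Sum>p\<in>?Perm. \<Prod>i = 0..<n. ?A $$ (i, p i))"
    by (rule sum.reindex_bij_witness[of _ "\<lambda>p. Hilbert_Choice.inv sh \<circ> p" "\<lambda>p. sh \<circ> p"])
      (auto simp: permutes_compose permutes_inv sh permutes_inverses[OF sh] fun_eq_iff)
  also have "\<dots> = permanent ?A" by (simp add: permanent_def)
  finally show ?thesis .
qed

section \<open>Skew symmetry of the transfer matrix\<close>

text \<open>Reversal matches the steps on the two sides and turns \<open>c\<close> into
  \<open>d - c\<close>, hence the coefficient into its negative.\<close>

lemma transfer_weight_reflect:
  fixes b :: "nat \<Rightarrow> 'a::comm_ring_1"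
  assumes S: "S \<subseteq> {..<d}" and S': "S' \<subseteq> {..<d}"
    and b: "\<And>c. c \<le> d \<Longrightarrow> b (d - c) = - b c"
  shows "transfer_weight d b (reflect_compl d S') (reflect_compl d S) = - transfer_weight d b S S'"
proof -
  let ?step = "\<lambda>c S S'. c \<notin> S \<and> 0 \<in> insert c S \<and> S' = {x. Suc x \<in> insert c S}"
  let ?R = "reflect_compl d"
  have R: "?R X \<subseteq> {..<d}" for X by (auto simp: reflect_compl_def)
  have iff: "?step (d - c) (?R S') (?R S) \<longleftrightarrow> ?step c S S'" if c: "c \<le> d" for c
  proof
    assume "?step c S S'"
    then show "?step (d - c) (?R S') (?R S)" using reflect_compl_step[OF S c, of S'] by blast
  next
    \<comment> \<open>The converse is the forward direction for the reversed step, as the reflected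
      complement is an involution.\<close>
    assume "?step (d - c) (?R S') (?R S)"
    then have "?step (d - (d - c)) (?R (?R S)) (?R (?R S'))"
      using reflect_compl_step[OF R, of "d - c" S' "?R S"] by simp
    then show "?step c S S'" using c S S' by (simp add: reflect_compl_reflect_compl)
  qed
  have "transfer_weight d b (?R S') (?R S) =
    (\<Sum>c\<le>d. b (d - c) * of_bool (?step (d - c) (?R S') (?R S)))"
    unfolding transfer_weight_def
    by (rule sum.reindex_bij_witness[of _ "\<lambda>c. d - c" "\<lambda>c. d - c"]) auto
  also have "\<dots> = (\<Sum>c\<le>d. - (b c * of_bool (?step c S S')))"
  proof (rule sum.cong[OF refl])
    fix c assume "c \<in> {..d}"
    then have c: "c \<le> d" by simp
    show "b (d - c) * of_bool (?step (d - c) (?R S') (?R S)) = - (b c * of_bool (?step c S S'))"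
      unfolding iff[OF c] b[OF c] by simp
  qed
  finally show ?thesis by (simp add: transfer_weight_def sum_negf)
qed

text \<open>Relabelling the states by reflected complement carries the transpose of the transfer
  matrix to its negative, and transposition preserves the characteristic polynomial.\<close>

lemma char_poly_uminus_transfer_mat:
  fixes b :: "nat \<Rightarrow> 'a::comm_ring_1"
  assumes e: "bij_betw e {0..<2 ^ d} (Pow {..<d})"
    and b: "\<And>c. c \<le> d \<Longrightarrow> b (d - c) = - b c"
  shows "char_poly (- transfer_mat d b e) = char_poly (transfer_mat d b e)"
proof -
  let ?T = "transfer_mat d b e" and ?R = "reflect_compl d"
  define p where "p i = inv_into {0..<2 ^ d} e (?R (e i))" for i
  have R: "?R X \<in> Pow {..<d}" for X by (auto simp: reflect_compl_def)
  have e_mem: "e i \<subseteq> {..<d}" if "i < 2 ^ d" for i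
    using e that by (auto simp: bij_betw_def)
  have ep: "e (p i) = ?R (e i)" for i
    unfolding p_def using R e by (intro f_inv_into_f) (simp add: bij_betw_def)
  have p_less: "p i < 2 ^ d" for i
    using inv_into_into[of "?R (e i)" e "{0..<2 ^ d}"] R e by (simp add: p_def bij_betw_def)
  have "p (p i) = i" if "i < 2 ^ d" for i
  proof -
    have "e (p (p i)) = e i" by (simp add: ep reflect_compl_reflect_compl e_mem that)
    then show ?thesis
      using inj_onD[OF bij_betw_imp_inj_on[OF e], of "p (p i)" i] p_less that by simp
  qed
  then have "char_poly (transpose_mat ?T) = char_poly (- ?T)"
    using p_less
    by (intro char_poly_involution[of _ "2 ^ d" _ p])
      (auto simp: transfer_mat_def ep transfer_weight_reflect e_mem b)
  then show ?thesis by (simp add: char_poly_transpose_mat[OF transfer_mat_carrier])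
qed

section \<open>The recurrence for even sizes\<close>

lemma sum_even_indices:
  fixes f :: "nat \<Rightarrow> 'a::comm_monoid_add"
  assumes "\<And>j. odd j \<Longrightarrow> f j = 0"
  shows "(\<Sum>j\<le>2 * N. f j) = (\<Sum>i\<le>N. f (2 * i))"
  using assms by (induction N) auto

text \<open>Cayley--Hamilton is multiplied by the power \<open>2 * k\<close> of \<open>A\<close> and
  summed over the diagonal. The odd coefficients vanish, so only traces of even powers
  remain.\<close>

lemma trace_power_recurrence:
  fixes A :: "'a::field mat"
  assumes "CHAR('a) \<noteq> 2" and A: "A \<in> carrier_mat (2 * N) (2 * N)"
    and eq: "char_poly (- A) = char_poly A"
  shows "(\<Sum>i\<le>N. coeff (char_poly A) (2 * i) *
    (\<Sum>l = 0..<2 * N. (A ^\<^sub>m (2 * (k + i))) $$ (l, l))) = 0"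
proof -
  let ?p = "char_poly A"
  have "(\<Sum>i\<le>N. coeff ?p (2 * i) * (\<Sum>l = 0..<2 * N. (A ^\<^sub>m (2 * (k + i))) $$ (l, l))) =
    (\<Sum>i\<le>N. coeff ?p (2 * i) * (\<Sum>l = 0..<2 * N. (A ^\<^sub>m (2 * k + 2 * i)) $$ (l, l)))"
    by (simp add: distrib_left)
  also have "\<dots> =
    (\<Sum>j\<le>2 * N. coeff ?p j * (\<Sum>l = 0..<2 * N. (A ^\<^sub>m (2 * k + j)) $$ (l, l)))"
    by (rule sum_even_indices[symmetric]) (use coeff_char_poly_odd[OF assms(1) A _ _ eq] in simp)
  also have "\<dots> =
    (\<Sum>l = 0..<2 * N. \<Sum>j\<le>2 * N. coeff ?p j * (A ^\<^sub>m (2 * k + j)) $$ (l, l))"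
    unfolding sum_distrib_left by (rule sum.swap)
  also have "\<dots> = 0"
    using Cayley_Hamilton_shifted[OF A] by (intro sum.neutral) simp
  finally show ?thesis .
qed

theorem proposition6p9:
  fixes a :: "int \<Rightarrow> 'a::field" and m :: nat
  assumes "CHAR('a) \<noteq> 2"
    and "m \<ge> 1"
    and "a 0 = 0"
    and "\<And>s. 1 \<le> s \<Longrightarrow> s \<le> int m \<Longrightarrow> a (- s) = - a s"
  shows "(\<forall>n>2 * m. odd n \<longrightarrow> permanent (banded_circulant m a n) = 0) \<and>
    (\<exists>q. annihilator_beyond m (\<lambda>k. permanent (banded_circulant m a (2 * k))) q \<and>
         degree q \<le> 2 ^ (2 * m - 1))"
proof (intro conjI allI impI)
  have skew: "a (- s) = - a s" if "\<bar>s\<bar> \<le> int m" for s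
    using assms(3) assms(4)[of s] assms(4)[of "- s"] that
    by (cases s "0 :: int" rule: linorder_cases) auto
  show "permanent (banded_circulant m a n) = 0" if "n > 2 * m" "odd n" for n
  proof -
    have "permanent (banded_circulant m a n) = (- 1) ^ n * permanent (banded_circulant m a n)"
      by (intro permanent_skew banded_circulant_carrier banded_circulant_skew skew)
    then have "2 * permanent (banded_circulant m a n) = 0"
      using \<open>odd n\<close> by (simp add: eq_neg_iff_add_eq_0)
    then show ?thesis using two_neq_0_if_CHAR_neq_2[OF assms(1)] by simp
  qed
  let ?d = "2 * m" and ?N = "2 ^ (2 * m - 1) :: nat"
  let ?b = "\<lambda>c. a (int c - int m)"
  \<comment> \<open>\<open>m \<ge> 1\<close> makes the number of states even.\<close>
  have N: "2 ^ ?d = 2 * ?N" using \<open>m \<ge> 1\<close> by (simp flip: power_Suc)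
  obtain e where e: "bij_betw e {0..<2 ^ (2 * m) :: nat} (Pow {..<?d})"
    using ex_bij_betw_nat_finite[of "Pow {..<?d}"] by (auto simp: card_Pow)
  define T where "T = transfer_mat ?d ?b e"
  have T: "T \<in> carrier_mat (2 * ?N) (2 * ?N)" unfolding T_def N[symmetric] by simp
  \<comment> \<open>With \<open>s = c - m\<close>, reflecting \<open>c\<close> changes the sign of
    \<open>s\<close>.\<close>
  have b: "?b (?d - c) = - ?b c" if "c \<le> ?d" for c
    using skew[of "int c - int m"] that by (simp add: of_nat_diff)
  have even: "char_poly (- T) = char_poly T"
    unfolding T_def using b by (intro char_poly_uminus_transfer_mat e)
  \<comment> \<open>The characteristic polynomial of \<open>T\<close> is \<open>q\<close> evaluated
    at t squared.\<close>
  define q where "q = (\<Sum>i\<le>?N. monom (coeff (char_poly T) (2 * i)) i)"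
  have coeff_q: "coeff q i = (if i \<le> ?N then coeff (char_poly T) (2 * i) else 0)" for i
    by (simp add: q_def coeff_sum)
  have "coeff q ?N = 1" using degree_monic_char_poly[OF T] by (simp add: coeff_q)
  \<comment> \<open>The exact degree matters, since \<open>annihilator_beyond\<close> sums up to
    \<open>degree q\<close> and asks for a monic polynomial.\<close>
  moreover have "degree q = ?N"
  proof (rule antisym)
    show "degree q \<le> ?N" by (rule degree_le) (simp add: coeff_q)
    show "?N \<le> degree q" by (rule le_degree) (simp only: \<open>coeff q ?N = 1\<close> one_neq_zero not_False_eq_True)
  qed
  moreover have "(\<Sum>i\<le>?N. coeff q i * permanent (banded_circulant m a (2 * (k + i)))) = 0"
    if "k > m" for k
  proof -
    have "(\<Sum>i\<le>?N. coeff q i * permanent (banded_circulant m a (2 * (k + i)))) =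
      (\<Sum>i\<le>?N. coeff (char_poly T) (2 * i) *
        (\<Sum>l = 0..<2 * ?N. (T ^\<^sub>m (2 * (k + i))) $$ (l, l)))"
    proof (intro sum.cong refl arg_cong2[of _ _ _ _ "(*)"])
      fix i
      \<comment> \<open>For \<open>k > m\<close> all sizes involved are in the range of the trace
        formula.\<close>
      have "?d < 2 * (k + i)" using that by simp
      then show "permanent (banded_circulant m a (2 * (k + i))) =
          (\<Sum>l = 0..<2 * ?N. (T ^\<^sub>m (2 * (k + i))) $$ (l, l))"
        unfolding permanent_banded_circulant T_def N[symmetric]
        by (rule permanent_circulant_eq_trace[OF _ e])
    qed (simp add: coeff_q)
    also have "\<dots> = 0" by (rule trace_power_recurrence[OF assms(1) T even])
    finally show ?thesis .
  qed
  ultimately show "\<exists>q. annihilator_beyond m (\<lambda>k. permanent (banded_circulant m a (2 * k))) q \<and>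
      degree q \<le> ?N"
    unfolding annihilator_beyond_def by (intro exI[of _ q]) auto
qed

end
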